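(* Let $N$ be a sequenceable finite group of even order and let $k\ge 0$ be an integer. Then $N\times(\mathbb{Z}_2)^k$ has a cyclic D-sequence.
   Context: All groups are finite; $1_G$ denotes the identity of a group $G$; $\mathbb{Z}_2$ is the cyclic group of order $2$. For a sequence ${\bf g}: g_0,\ldots,g_m$ in a group $G$ with $g_0=1_G$, the sequence of consecutive quotients ${\bf \bar g}:\bar g_0,\ldots,\bar g_m$ is defined by $\bar g_0=1_G$ and $\bar g_i=g_{i-1}^{-1}g_i$ for $1\le i\le m$. A finite group $G$ of order $n$ is sequenceable if there is a sequence ${\bf g}: g_0,\ldots,g_{n-1}$ in $G$ with $g_0=1_G$ such that every element of $G$ appears exactly once in each of ${\bf g}$ and ${\bf \bar g}$. A D-sequence in a finite group $G$ of order $n$ is a sequence ${\bf g}: g_0,\ldots,g_{2n-1}$ in $G$ with $g_0=1_G$ such that every element of $G$ appears exactly twice in each of ${\bf g}$ and ${\bf \bar g}$. A D-sequence is cyclic if $g_{2n-1}=1_G$. *)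

theory Defs
  imports "HOL-Algebra.Product_Groups"
begin

text \<open>
  A sequence of length \<open>L\<close> is a function on \<open>nat\<close> of which only the values at the indices
  \<open>i < L\<close> matter.
\<close>

definition quotient_seq :: "('a, 'b) monoid_scheme \<Rightarrow> (nat \<Rightarrow> 'a) \<Rightarrow> nat \<Rightarrow> 'a" where
  "quotient_seq G g i = (if i = 0 then \<one>\<^bsub>G\<^esub> else inv\<^bsub>G\<^esub> (g (i - 1)) \<otimes>\<^bsub>G\<^esub> g i)"

definition occurrences :: "nat \<Rightarrow> (nat \<Rightarrow> 'a) \<Rightarrow> 'a \<Rightarrow> nat" where
  "occurrences L g x = card {i. i < L \<and> g i = x}"

definition sequenceable :: "('a, 'b) monoid_scheme \<Rightarrow> bool" where
  "sequenceable G \<longleftrightarrow>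
     (\<exists>g. (\<forall>i < order G. g i \<in> carrier G) \<and> g 0 = \<one>\<^bsub>G\<^esub> \<and>
          (\<forall>x \<in> carrier G. occurrences (order G) g x = 1 \<and>
                           occurrences (order G) (quotient_seq G g) x = 1))"

definition D_sequence :: "('a, 'b) monoid_scheme \<Rightarrow> (nat \<Rightarrow> 'a) \<Rightarrow> bool" where
  "D_sequence G g \<longleftrightarrow>
     (\<forall>i < 2 * order G. g i \<in> carrier G) \<and> g 0 = \<one>\<^bsub>G\<^esub> \<and>
     (\<forall>x \<in> carrier G. occurrences (2 * order G) g x = 2 \<and>
                      occurrences (2 * order G) (quotient_seq G g) x = 2)"

definition cyclic_D_sequence :: "('a, 'b) monoid_scheme \<Rightarrow> (nat \<Rightarrow> 'a) \<Rightarrow> bool" where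
  "cyclic_D_sequence G g \<longleftrightarrow> D_sequence G g \<and> g (2 * order G - 1) = \<one>\<^bsub>G\<^esub>"

abbreviation Z2_power :: "nat \<Rightarrow> (nat \<Rightarrow> int) monoid" where
  "Z2_power k \<equiv> product_group {..<k} (\<lambda>_. integer_mod_group 2)"

end

theory Submission
  imports Defs "HOL-Library.Multiset"
begin

text \<open>
  A cyclic D-sequence of \<open>G\<close> is a closed walk in the complete Cayley digraph of \<open>G\<close> (an edge
  \<open>x \<rightarrow> y\<close> carries the label \<open>x\<^sup>-\<^sup>1y\<close>) that visits every vertex twice and uses every label twice,
  the label \<open>\<one>\<close> of the step from the last entry back to the first being included. The proof is by
  induction on \<open>k\<close>.

  For \<open>k = 0\<close>, a sequencing of \<open>N\<close> followed by its own reversal is such a walk: the way back uses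
  the inverses of the labels of the way out, and the turning point supplies the second label \<open>\<one>\<close>
  (\<open>sequenceable_imp_D_walk\<close>).

  For the step from \<open>G\<close> to \<open>G \<times> \<int>\<^sub>2\<close>, attach to the two edges with any given label the
  different bits 0 and 1, giving 0 to the one that comes first
  (\<open>mset_mark_repetitions\<close>). Starting from the identity, the walk then lifts uniquely to a
  walk \<open>u\<close> in \<open>G \<times> \<int>\<^sub>2\<close> that uses every label of that group exactly once. The number of bits 1 is
  the order of \<open>G\<close>, which is even, and so \<open>u\<close> is closed. With \<open>t = (\<one>, 1)\<close>, the translate \<open>tu\<close> is a
  closed walk with the same labels, and \<open>u\<close> and \<open>tu\<close> together have the right numbers of visits
  and of labels. What remains is to join them into a single walk. Since one of the two
  edges labelled \<open>\<one>\<close> received the bit 1, the label \<open>t\<close> occurs in \<open>u\<close>; its edge joins some \<open>p\<close> to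
  \<open>tp\<close>, so that \<open>u\<close> and \<open>tu\<close> meet there and can be spliced (\<open>splice_translate\<close>).
\<close>

section \<open>Lists of consecutive quotients\<close>

fun quotients :: "('a, 'b) monoid_scheme \<Rightarrow> 'a list \<Rightarrow> 'a list" where
  "quotients G (x # y # zs) = (inv\<^bsub>G\<^esub> x \<otimes>\<^bsub>G\<^esub> y) # quotients G (y # zs)"
| "quotients G _ = []"

lemma length_quotients [simp]: "length (quotients G xs) = length xs - 1"
  by (induction G xs rule: quotients.induct) auto

lemma quotients_append:
  assumes "xs \<noteq> []" "ys \<noteq> []"
  shows "quotients G (xs @ ys) =
    quotients G xs @ (inv\<^bsub>G\<^esub> (last xs) \<otimes>\<^bsub>G\<^esub> hd ys) # quotients G ys"
  using assms
proof (induction xs rule: induct_list012)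
  case (2 x)
  then show ?case by (cases ys) auto
qed auto

lemma quotients_append_overlap:
  "quotients G (xs @ v # ys) = quotients G (xs @ [v]) @ quotients G (v # ys)"
  using quotients_append[of "xs @ [v]" ys G] by (cases ys) auto

lemma in_quotientsE:
  assumes "s \<in> set (quotients G xs)"
  obtains A p q B where "xs = A @ p # q # B" "s = inv\<^bsub>G\<^esub> p \<otimes>\<^bsub>G\<^esub> q"
proof -
  have "\<exists>A p q B. xs = A @ p # q # B \<and> s = inv\<^bsub>G\<^esub> p \<otimes>\<^bsub>G\<^esub> q"
    using assms
  proof (induction G xs rule: quotients.induct)
    case (1 G x y zs)
    show ?case
    proof (cases "s = inv\<^bsub>G\<^esub> x \<otimes>\<^bsub>G\<^esub> y")
      case True
      then show ?thesis by (metis append_Nil)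
    next
      case False
      then obtain A p q B where "y # zs = A @ p # q # B" "s = inv\<^bsub>G\<^esub> p \<otimes>\<^bsub>G\<^esub> q"
        using 1 by auto
      then show ?thesis by (metis append_Cons)
    qed
  qed auto
  then show thesis using that by blast
qed

lemma quotients_map_upt:
  "\<one>\<^bsub>G\<^esub> # quotients G (map g [0..<Suc m]) = map (quotient_seq G g) [0..<Suc m]"
proof (induction m)
  case 0
  then show ?case by (simp add: quotient_seq_def)
next
  case (Suc m)
  have "quotients G (map g [0..<Suc m] @ [g (Suc m)]) =
      quotients G (map g [0..<Suc m]) @ [quotient_seq G g (Suc m)]"
    by (subst quotients_append) (simp_all add: quotient_seq_def last_map)
  with Suc show ?case by simp
qed

lemma (in group) quotients_map_left_mult:
  assumes "t \<in> carrier G" "set xs \<subseteq> carrier G"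
  shows "quotients G (map (\<lambda>x. t \<otimes> x) xs) = quotients G xs"
  using assms(2)
proof (induction xs rule: induct_list012)
  case (3 x y zs)
  then have "inv (t \<otimes> x) \<otimes> (t \<otimes> y) = inv x \<otimes> y"
    using assms(1) by (simp add: inv_mult_group m_assoc inv_solve_left')
  with 3 show ?case by simp
qed auto

lemma (in group) quotients_rev:
  assumes "set xs \<subseteq> carrier G"
  shows "quotients G (rev xs) = rev (map (\<lambda>x. inv x) (quotients G xs))"
  using assms
proof (induction xs rule: induct_list012)
  case (3 x y zs)
  then have "quotients G (rev (y # zs) @ [x]) = quotients G (rev (y # zs)) @ [inv y \<otimes> x]"
    by (subst quotients_append) (simp_all add: last_rev)
  with 3 show ?case by (simp add: inv_mult_group)
qed auto

lemma (in group_hom) quotients_map_hom: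
  assumes "set xs \<subseteq> carrier G"
  shows "quotients H (map h xs) = map h (quotients G xs)"
  using assms by (induction xs rule: induct_list012) auto

section \<open>Closed walks\<close>

text \<open>
  The list form of a cyclic D-sequence. Multisets of entries and of labels make the later
  cutting and gluing of walks a matter of adding multisets. The extra \<open>\<one>\<close> in front of the
  quotients is the quotient of index 0; it can be read as the label of the edge that closes the
  walk.
\<close>

definition D_walk :: "('a, 'b) monoid_scheme \<Rightarrow> 'a list \<Rightarrow> bool" where
  "D_walk G xs \<longleftrightarrow> xs \<noteq> [] \<and> hd xs = \<one>\<^bsub>G\<^esub> \<and> last xs = \<one>\<^bsub>G\<^esub> \<and>
     mset xs = repeat_mset 2 (mset_set (carrier G)) \<and>
     mset (\<one>\<^bsub>G\<^esub> # quotients G xs) = repeat_mset 2 (mset_set (carrier G))"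

lemma count_mset_map_upt: "count (mset (map f [0..<L])) x = occurrences L f x"
proof (induction L)
  case 0
  then show ?case by (simp add: occurrences_def)
next
  case (Suc L)
  have "{i. i < Suc L \<and> f i = x} =
      (if f L = x then insert L {i. i < L \<and> f i = x} else {i. i < L \<and> f i = x})"
    by (auto simp: less_Suc_eq)
  with Suc show ?case by (simp add: occurrences_def)
qed

lemma mset_map_upt_eq_repeat_mset:
  assumes "finite C" "\<And>i. i < L \<Longrightarrow> f i \<in> C" "\<And>x. x \<in> C \<Longrightarrow> occurrences L f x = m"
  shows "mset (map f [0..<L]) = repeat_mset m (mset_set C)"
proof (rule multiset_eqI)
  fix x
  have "occurrences L f x = 0" if "x \<notin> C"
    using that assms(2) by (auto simp: occurrences_def)
  then show "count (mset (map f [0..<L])) x = count (repeat_mset m (mset_set C)) x"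
    unfolding count_mset_map_upt using assms by (cases "x \<in> C") auto
qed

lemma cyclic_D_sequence_of_D_walk:
  assumes "finite (carrier G)" "D_walk G xs"
  shows "cyclic_D_sequence G (\<lambda>i. xs ! i)"
proof -
  let ?C = "mset_set (carrier G)"
  have xs: "xs \<noteq> []" "hd xs = \<one>\<^bsub>G\<^esub>" "last xs = \<one>\<^bsub>G\<^esub>" "mset xs = repeat_mset 2 ?C"
    and quo: "mset (\<one>\<^bsub>G\<^esub> # quotients G xs) = repeat_mset 2 ?C"
    using assms by (auto simp: D_walk_def)
  have len: "length xs = 2 * order G"
    using arg_cong[OF xs(4), of size] by (simp add: order_def)
  have mapxs: "map (\<lambda>i. xs ! i) [0..<2 * order G] = xs"
    by (metis len map_nth)
  obtain m where m: "2 * order G = Suc m"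
    using xs(1) len by (metis length_0_conv not0_implies_Suc)
  have mapq: "map (quotient_seq G (\<lambda>i. xs ! i)) [0..<2 * order G] = \<one>\<^bsub>G\<^esub> # quotients G xs"
    using quotients_map_upt[of G "\<lambda>i. xs ! i" m] mapxs m by simp
  have "set xs = carrier G"
    using arg_cong[OF xs(4), of set_mset] assms(1) by (simp add: numeral_2_eq_2)
  then have "\<forall>i < 2 * order G. xs ! i \<in> carrier G"
    using len by (metis nth_mem)
  moreover have "occurrences (2 * order G) (\<lambda>i. xs ! i) x = 2"
    and "occurrences (2 * order G) (quotient_seq G (\<lambda>i. xs ! i)) x = 2"
    if "x \<in> carrier G" for x
    unfolding count_mset_map_upt[symmetric] mapxs mapq quo xs(4)
    using that assms(1) by simp_all
  moreover have "xs ! 0 = \<one>\<^bsub>G\<^esub>" "xs ! (2 * order G - 1) = \<one>\<^bsub>G\<^esub>"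
    using xs len by (auto simp: hd_conv_nth last_conv_nth)
  ultimately show ?thesis
    by (auto simp: cyclic_D_sequence_def D_sequence_def)
qed

lemma D_walk_iso:
  assumes "group G" "group H" "h \<in> iso G H" "D_walk G xs" "finite (carrier G)"
  shows "D_walk H (map h xs)"
proof -
  have bij: "bij_betw h (carrier G) (carrier H)" and hom: "h \<in> hom G H"
    using assms(3) by (auto simp: iso_def)
  interpret group_hom G H h
    using assms(1,2) hom by (simp add: group_hom_def group_hom_axioms_def)
  have im: "image_mset h (repeat_mset 2 (mset_set (carrier G))) =
      repeat_mset 2 (mset_set (carrier H))"
    using bij by (auto simp: bij_betw_def image_mset_mset_set numeral_2_eq_2)
  have xs: "xs \<noteq> []" "hd xs = \<one>\<^bsub>G\<^esub>" "last xs = \<one>\<^bsub>G\<^esub>"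
    "mset xs = repeat_mset 2 (mset_set (carrier G))"
    "mset (\<one>\<^bsub>G\<^esub> # quotients G xs) = repeat_mset 2 (mset_set (carrier G))"
    using assms by (auto simp: D_walk_def)
  have "set xs = carrier G"
    using arg_cong[OF xs(4), of set_mset] assms(5) by (simp add: numeral_2_eq_2)
  then have "\<one>\<^bsub>H\<^esub> # quotients H (map h xs) = map h (\<one>\<^bsub>G\<^esub> # quotients G xs)"
    by (simp add: quotients_map_hom)
  then have "mset (\<one>\<^bsub>H\<^esub> # quotients H (map h xs)) = repeat_mset 2 (mset_set (carrier H))"
    using xs(5) im by (metis mset_map)
  moreover have "mset (map h xs) = repeat_mset 2 (mset_set (carrier H))"
    using xs(4) im by simp
  ultimately show ?thesis
    using xs(1-3) by (simp add: D_walk_def hd_map last_map)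
qed

text \<open>
  The walk goes along a sequencing and then back. Together with the leading \<open>\<one>\<close>, the labels of
  either half run through the group once, those of the second half because inversion permutes
  the group; the \<open>\<one>\<close> that the second half needs is the quotient at the turning point.
\<close>

lemma (in group) sequenceable_imp_D_walk:
  assumes "finite (carrier G)" "sequenceable G"
  shows "\<exists>xs. D_walk G xs"
proof -
  obtain g where g: "\<And>i. i < order G \<Longrightarrow> g i \<in> carrier G" "g 0 = \<one>"
    and occ: "\<And>x. x \<in> carrier G \<Longrightarrow> occurrences (order G) g x = 1"
      "\<And>x. x \<in> carrier G \<Longrightarrow> occurrences (order G) (quotient_seq G g) x = 1"
    using assms(2) by (auto simp: sequenceable_def)
  obtain m where m: "order G = Suc m"
    using assms(1) order_gt_0_iff_finite gr0_implies_Suc by blast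
  define as where "as = map g [0..<order G]"
  have ne: "as \<noteq> []" and hd: "hd as = \<one>"
    by (simp_all add: as_def m g hd_map del: upt_Suc)
  have car: "set as \<subseteq> carrier G"
    using g by (auto simp: as_def)
  have mset_as: "mset as = mset_set (carrier G)"
    using mset_map_upt_eq_repeat_mset[OF assms(1) g(1) occ(1)] by (simp add: as_def)
  have "quotient_seq G g i \<in> carrier G" if "i < order G" for i
    using that g(1) by (auto simp: quotient_seq_def)
  from mset_map_upt_eq_repeat_mset[OF assms(1) this occ(2)]
  have mset_q: "mset (\<one> # quotients G as) = mset_set (carrier G)"
    using quotients_map_upt[of G g m] by (simp add: as_def m)
  have "image_mset (\<lambda>x. inv x) (mset_set (carrier G)) = mset_set (carrier G)"
  proof -
    have "(\<lambda>x. inv x) ` carrier G = carrier G"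
      by (auto simp: image_iff) (metis inv_closed inv_inv)
    then show ?thesis
      using inv_inj by (subst image_mset_mset_set) auto
  qed
  then have mset_q': "mset (\<one> # map (\<lambda>x. inv x) (quotients G as)) = mset_set (carrier G)"
    using mset_q by (metis inv_one list.simps(9) mset_map)
  have l1: "inv (last as) \<otimes> last as = \<one>"
    using car ne by (auto intro!: l_inv)
  have "quotients G (as @ rev as) =
      quotients G as @ \<one> # rev (map (\<lambda>x. inv x) (quotients G as))"
    using ne car l1 by (subst quotients_append) (simp_all add: hd_rev quotients_rev)
  then have "mset (\<one> # quotients G (as @ rev as)) = repeat_mset 2 (mset_set (carrier G))"
    using mset_q mset_q' by (simp add: numeral_2_eq_2)
  then have "D_walk G (as @ rev as)"
    using ne hd mset_as by (simp add: D_walk_def last_rev numeral_2_eq_2)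
  then show ?thesis ..
qed

section \<open>From a group to its product with the group of order two\<close>

text \<open>
  Write \<open>u = A p q B\<close> with \<open>q = tp\<close>. Then \<open>tu = (tA) q p (tB)\<close>, so the edges \<open>p \<rightarrow> q\<close> of \<open>u\<close> and
  \<open>q \<rightarrow> p\<close> of \<open>tu\<close> are reverse to each other. The joined walk follows \<open>u\<close> to \<open>p\<close>, changes there to
  \<open>tu\<close> and traverses \<open>tB\<close>, uses the closing edge of \<open>tu\<close> to continue with \<open>tA\<close> up to \<open>q\<close>,
  takes \<open>q \<rightarrow> p\<close> and \<open>p \<rightarrow> q\<close>, and completes \<open>u\<close>. Every edge of both walks is used once.
\<close>

lemma (in group) splice_translate:
  assumes t: "t \<in> carrier G" "t \<otimes> t = \<one>"
    and u: "set u \<subseteq> carrier G" "u \<noteq> []" "hd u = \<one>" "last u = \<one>"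
    and split: "u = A @ p # q # B" "q = t \<otimes> p"
  shows "\<exists>w. w \<noteq> [] \<and> hd w = \<one> \<and> last w = \<one> \<and>
    mset w = mset u + mset (map (\<lambda>x. t \<otimes> x) u) \<and>
    mset (\<one> # quotients G w) = repeat_mset 2 (mset (\<one> # quotients G u))"
proof -
  let ?t = "\<lambda>x. t \<otimes> x"
  let ?w = "(A @ [p]) @ map ?t B @ (map ?t A @ [q]) @ [p] @ (q # B)"
  have car: "set A \<subseteq> carrier G" "set B \<subseteq> carrier G" "p \<in> carrier G" "q \<in> carrier G"
    using u(1) split(1) by auto
  have tq: "t \<otimes> q = p"
    using t car split(2) by (simp flip: m_assoc)
  have qp: "inv q \<otimes> p = inv p \<otimes> q"
    using quotients_map_left_mult[of t "[p, q]"] t car tq split(2) by simp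
  have qu: "quotients G u =
      quotients G (A @ [p]) @ (inv p \<otimes> q) # quotients G (q # B)"
    using quotients_append[of "A @ [p]" "q # B" G] split(1) by simp
  have qA: "quotients G (map ?t A @ [q]) = quotients G (A @ [p])"
    using quotients_map_left_mult[of t "A @ [p]"] t car split(2) by simp
  have qB: "quotients G (p # map ?t B) = quotients G (q # B)"
    using quotients_map_left_mult[of t "q # B"] t car tq by simp
  have lastB: "last (p # map ?t B) = t"
  proof -
    have "last (map ?t (q # B)) = t"
      using u split(1) t by (subst last_map) auto
    then show ?thesis by (simp add: tq)
  qed
  have hdA: "hd (map ?t A @ [q]) = t"
  proof -
    have "hd (map ?t (A @ [p])) = t"
      using u split(1) t by (subst hd_map) (auto simp: hd_append)
    then show ?thesis by (simp add: split(2))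
  qed
  (* The closing edge of the translate, from t back to t, yields the quotient \<one> in the middle. *)
  let ?Z = "(map ?t A @ [q]) @ [p] @ (q # B)"
  have e1: "quotients G ?w = quotients G (A @ [p]) @ quotients G (p # (map ?t B @ ?Z))"
    using quotients_append_overlap[of G A p "map ?t B @ ?Z"] by simp
  have e2: "quotients G ((p # map ?t B) @ ?Z) =
      quotients G (q # B) @ \<one> # quotients G ?Z"
    by (subst quotients_append) (use qB lastB hdA t in \<open>auto simp: hd_append\<close>)
  have e3: "quotients G ?Z =
      quotients G (A @ [p]) @ (inv p \<otimes> q) # (inv p \<otimes> q) # quotients G (q # B)"
    by (subst quotients_append) (use qA qp in auto)
  have "mset (\<one> # quotients G ?w) = repeat_mset 2 (mset (\<one> # quotients G u))"
    using e1 e2 e3 qu by (simp add: numeral_2_eq_2)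
  moreover have "mset ?w = mset u + mset (map ?t u)"
    using split tq by simp
  moreover have "hd ?w = \<one>" "last ?w = \<one>" "?w \<noteq> []"
    using u split(1) by (auto simp: hd_append)
  ultimately show ?thesis by (intro exI[of _ ?w] conjI)
qed

text \<open>
  The bit at \<open>i\<close> says whether the entry occurs before \<open>i\<close>; hence of two equal entries exactly
  one, the later one, receives 1. For a list of quotients this leaves the bit 0 to the closing
  edge at index 0, so that the other edge with label \<open>\<one>\<close> is the one that changes the second
  coordinate.
\<close>

lemma mset_mark_repetitions:
  fixes L :: "'a list"
  assumes "finite C" "mset L = repeat_mset 2 (mset_set C)"
  shows "mset (map (\<lambda>i. (L ! i, of_bool (L ! i \<in> set (take i L)) :: int)) [0..<length L]) =
    mset_set (C \<times> {0, 1})"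
proof -
  let ?f = "\<lambda>i. (L ! i, of_bool (L ! i \<in> set (take i L)) :: int)"
  have setL: "set L = C"
    using arg_cong[OF assms(2), of set_mset] assms(1) by (simp add: numeral_2_eq_2)
  have "occurrences (length L) ?f (x, e) = 1" if "x \<in> C" "e \<in> {0, 1}" for x e
  proof -
    have "card {i. i < length L \<and> L ! i = x} = 2"
      using count_mset_map_upt[of "\<lambda>i. L ! i" "length L" x] assms that
      by (simp add: map_nth occurrences_def)
    then obtain a b where ab: "{i. i < length L \<and> L ! i = x} = {a, b}" "a \<noteq> b"
      by (auto simp: card_2_iff)
    (* p is the earlier and q the later occurrence of x *)
    obtain p q where pq: "{i. i < length L \<and> L ! i = x} = {p, q}" "p < q"
      using ab by (metis insert_commute linorder_neqE_nat)
    have iff: "i < length L \<and> L ! i = x \<longleftrightarrow> i = p \<or> i = q" for i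
      using pq(1) by blast
    have p: "x \<notin> set (take p L)"
    proof
      assume "x \<in> set (take p L)"
      then obtain i where "i < p" "i < length L" "L ! i = x"
        by (auto simp: in_set_conv_nth)
      then show False using iff[of i] pq(2) by auto
    qed
    have q: "x \<in> set (take q L)"
      using iff[of p] iff[of q] pq(2) by (auto simp: in_set_conv_nth intro!: exI[of _ p])
    have "{i. i < length L \<and> ?f i = (x, e)} = {if e = 0 then p else q}"
    proof (rule Set.set_eqI)
      fix i
      show "i \<in> {i. i < length L \<and> ?f i = (x, e)} \<longleftrightarrow> i \<in> {if e = 0 then p else q}"
        using iff[of i] p q pq(2) that(2) by (cases "i = p"; cases "i = q") auto
    qed
    then show ?thesis by (simp add: occurrences_def)
  qed
  then have "mset (map ?f [0..<length L]) = repeat_mset 1 (mset_set (C \<times> {0, 1}))"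
    using assms(1) setL by (intro mset_map_upt_eq_repeat_mset) auto
  then show ?thesis by simp
qed

lemma mset_map_add_cong:
  assumes "\<And>i. i \<in> set is \<Longrightarrow> {#f i, g i#} = {#f' i, g' i#}"
  shows "mset (map f is) + mset (map g is) = mset (map f' is) + mset (map g' is)"
  using assms
proof (induction "is")
  case (Cons i "is")
  then have "{#f i, g i#} + (mset (map f is) + mset (map g is)) =
      {#f' i, g' i#} + (mset (map f' is) + mset (map g' is))"
    by simp
  then show ?case by (simp add: add_mset_commute)
qed simp

text \<open>
  Evenness of the order makes the lifted walk \<open>u\<close> return to its starting point: as every label
  of the product occurs once in \<open>u\<close>, the second coordinates of its labels add up to the order
  of \<open>G\<close>.
\<close>

lemma D_walk_double:
  assumes "group G" "finite (carrier G)" "even (order G)" "D_walk G xs"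
  shows "\<exists>ws. D_walk (G \<times>\<times> integer_mod_group 2) ws"
proof -
  interpret G: group G by fact
  let ?H = "G \<times>\<times> integer_mod_group 2"
  interpret H: group ?H
    by (intro DirProd_group assms group_integer_mod_group)
  let ?C = "carrier G"
  have carZ: "carrier (integer_mod_group 2) = {0, 1}"
    by (auto simp: carrier_integer_mod_group)
  have carH: "carrier ?H = ?C \<times> {0, 1}"
    by (simp add: carZ)
  have xs: "xs \<noteq> []" "hd xs = \<one>\<^bsub>G\<^esub>" "last xs = \<one>\<^bsub>G\<^esub>" "mset xs = repeat_mset 2 (mset_set ?C)"
    and quo: "mset (\<one>\<^bsub>G\<^esub> # quotients G xs) = repeat_mset 2 (mset_set ?C)"
    using assms(4) by (auto simp: D_walk_def)
  have setxs: "set xs = ?C"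
    using arg_cong[OF xs(4), of set_mset] assms(2) by (simp add: numeral_2_eq_2)
  obtain m where m: "length xs = Suc m"
    using xs(1) by (metis length_0_conv not0_implies_Suc)
  define L where "L = \<one>\<^bsub>G\<^esub> # quotients G xs"
  have lenL: "length L = Suc m"
    using m by (simp add: L_def)
  have Lnth: "L ! i = quotient_seq G (\<lambda>i. xs ! i) i" if "i \<le> m" for i
  proof -
    have "L = map (quotient_seq G (\<lambda>i. xs ! i)) [0..<Suc m]"
      using quotients_map_upt[of G "\<lambda>i. xs ! i" m] map_nth[of xs] unfolding m L_def by argo
    then show ?thesis
      using that by (simp del: upt_Suc)
  qed
  define d where "d i = (of_bool (L ! i \<in> set (take i L)) :: int)" for i
  define e where "e i = (\<Sum>l\<le>i. d l) mod 2" for i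
  define u where "u = map (\<lambda>i. (xs ! i, e i)) [0..<Suc m]"
  have marked: "mset (map (\<lambda>i. (L ! i, d i)) [0..<Suc m]) = mset_set (?C \<times> {0, 1})"
    using mset_mark_repetitions[OF assms(2), of L] quo lenL by (simp add: L_def d_def)
  have e01: "e i \<in> {0, 1}" for i
    by (auto simp: e_def)
  have xsin: "xs ! i \<in> ?C" if "i \<le> m" for i
    using that m setxs by (metis le_imp_less_Suc nth_mem)
  have setu: "set u \<subseteq> carrier ?H"
    using xsin e01 by (auto simp: u_def carZ simp del: upt_Suc)
  have qstep: "quotient_seq ?H (\<lambda>i. (xs ! i, e i)) i = (L ! i, d i)" if "i \<le> m" for i
  proof (cases i)
    case 0
    then show ?thesis using Lnth[OF that]
      by (simp add: quotient_seq_def d_def)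
  next
    case (Suc j)
    have "inv\<^bsub>?H\<^esub> (xs ! j, e j) = (inv\<^bsub>G\<^esub> (xs ! j), inv\<^bsub>integer_mod_group 2\<^esub> (e j))"
      using xsin[of j] e01[of j] that Suc assms(1)
      by (intro inv_DirProd) (auto simp: carZ)
    moreover have "inv\<^bsub>integer_mod_group 2\<^esub> (e j) = (- e j) mod 2"
      using e01[of j] by (subst inv_integer_mod_group) (auto simp: carZ)
    moreover have "(- e j mod 2 + e (Suc j)) mod 2 = d (Suc j)"
    proof -
      have "(- (s mod 2) mod 2 + (s + b) mod 2) mod 2 = b mod 2" for s b :: int
        by presburger
      moreover have "d (Suc j) mod 2 = d (Suc j)"
        by (simp add: d_def)
      ultimately show ?thesis
        by (simp add: e_def)
    qed
    ultimately show ?thesis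
      using Lnth[OF that] Suc by (simp add: quotient_seq_def mult_integer_mod_group)
  qed
  have qu: "\<one>\<^bsub>?H\<^esub> # quotients ?H u = map (\<lambda>i. (L ! i, d i)) [0..<Suc m]"
    unfolding u_def quotients_map_upt using qstep by (intro map_cong) auto
  then have mset_qu: "mset (\<one>\<^bsub>?H\<^esub> # quotients ?H u) = mset_set (?C \<times> {0, 1})"
    using marked by simp
  have e0: "e 0 = 0"
    by (simp add: e_def d_def)
  have "(\<Sum>l\<le>m. d l) = sum_mset (image_mset snd (mset (map (\<lambda>i. (L ! i, d i)) [0..<Suc m])))"
  proof -
    have "sum_mset (image_mset snd (mset (map (\<lambda>i. (L ! i, d i)) [0..<Suc m]))) =
        sum_list (map d [0..<Suc m])"
      by (simp flip: mset_map sum_mset_sum_list add: o_def del: upt_Suc)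
    then show ?thesis
      by (simp add: interv_sum_list_conv_sum_set_nat atLeast0LessThan lessThan_Suc_atMost del: upt_Suc)
  qed
  also have "\<dots> = (\<Sum>p\<in>?C \<times> {0, 1}. snd p)"
    unfolding marked by (simp add: sum_unfold_sum_mset)
  also have "\<dots> = (\<Sum>x\<in>?C. \<Sum>b\<in>{0, 1}. b)"
    by (subst sum.cartesian_product) (simp add: case_prod_unfold)
  also have "\<dots> = int (order G)"
    by (simp add: order_def)
  finally have em: "e m = 0"
    using assms(3) by (simp add: e_def)
  have une: "u \<noteq> []"
    by (simp add: u_def)
  have hdu: "hd u = \<one>\<^bsub>?H\<^esub>"
    using xs m e0 by (simp add: u_def hd_map hd_conv_nth del: upt_Suc)
  have lastu: "last u = \<one>\<^bsub>?H\<^esub>"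
    using xs m em by (simp add: u_def last_conv_nth)
  define t where "t = (\<one>\<^bsub>G\<^esub>, 1 :: int)"
  have t: "t \<in> carrier ?H" "t \<otimes>\<^bsub>?H\<^esub> t = \<one>\<^bsub>?H\<^esub>"
    by (auto simp: t_def carZ mult_integer_mod_group)
  have "t \<in> set (\<one>\<^bsub>?H\<^esub> # quotients ?H u)"
    using arg_cong[OF mset_qu, of set_mset] assms(2) by (simp add: t_def)
  then have "t \<in> set (quotients ?H u)"
    by (auto simp: t_def)
  then obtain A p q B where split: "u = A @ p # q # B" and tpq: "t = inv\<^bsub>?H\<^esub> p \<otimes>\<^bsub>?H\<^esub> q"
    by (rule in_quotientsE)
  have pq: "p \<in> carrier ?H" "q \<in> carrier ?H"
    using setu split by auto
  then have "q = p \<otimes>\<^bsub>?H\<^esub> t"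
    using tpq t(1) H.inv_solve_left[of t p q] by blast
  also have "\<dots> = t \<otimes>\<^bsub>?H\<^esub> p"
    using pq by (cases p) (simp add: t_def mult_integer_mod_group add.commute)
  finally have q: "q = t \<otimes>\<^bsub>?H\<^esub> p" .
  obtain w where w: "w \<noteq> []" "hd w = \<one>\<^bsub>?H\<^esub>" "last w = \<one>\<^bsub>?H\<^esub>"
    and mw: "mset w = mset u + mset (map (\<lambda>x. t \<otimes>\<^bsub>?H\<^esub> x) u)"
    and qw: "mset (\<one>\<^bsub>?H\<^esub> # quotients ?H w) = repeat_mset 2 (mset (\<one>\<^bsub>?H\<^esub> # quotients ?H u))"
    using H.splice_translate[OF t setu une hdu lastu split q]
    by (elim exE conjE) (rule that; assumption)
  (* u and its translate together visit both lifts of every entry of xs once *)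
  have "mset u + mset (map (\<lambda>x. t \<otimes>\<^bsub>?H\<^esub> x) u) =
      mset (map (\<lambda>i. (xs ! i, 0)) [0..<Suc m]) + mset (map (\<lambda>i. (xs ! i, 1)) [0..<Suc m])"
    unfolding u_def map_map
  proof (rule mset_map_add_cong)
    fix i assume "i \<in> set [0..<Suc m]"
    then have "xs ! i \<in> ?C" using xsin by auto
    then show "{#(xs ! i, e i), ((\<lambda>x. t \<otimes>\<^bsub>?H\<^esub> x) \<circ> (\<lambda>i. (xs ! i, e i))) i#} =
        {#(xs ! i, 0), (xs ! i, 1)#}"
      using e01[of i] by (auto simp: t_def mult_integer_mod_group)
  qed
  also have "\<dots> = image_mset (\<lambda>x. (x, 0)) (mset xs) + image_mset (\<lambda>x. (x, 1)) (mset xs)"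
  proof -
    have "map (\<lambda>i. (xs ! i, b)) [0..<Suc m] = map (\<lambda>x. (x, b)) xs" for b :: int
      by (subst (2) map_nth[symmetric]) (simp add: m o_def del: upt_Suc)
    then show ?thesis by (simp only: mset_map)
  qed
  also have "\<dots> = repeat_mset 2 (mset_set (?C \<times> {0}) + mset_set (?C \<times> {1}))"
  proof -
    have "image_mset (\<lambda>x. (x, b)) (mset_set ?C) = mset_set (?C \<times> {b})" for b :: int
      by (subst image_mset_mset_set) (auto simp: inj_on_def intro!: arg_cong[of _ _ mset_set])
    then show ?thesis by (simp add: xs(4) numeral_2_eq_2)
  qed
  also have "mset_set (?C \<times> {0}) + mset_set (?C \<times> {1}) = mset_set (?C \<times> {0, 1::int})"
    using assms(2) by (subst mset_set_Union[symmetric]) (auto intro!: arg_cong[of _ _ mset_set])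
  finally have "mset w = repeat_mset 2 (mset_set (carrier ?H))"
    using mw carH by simp
  moreover have "mset (\<one>\<^bsub>?H\<^esub> # quotients ?H w) = repeat_mset 2 (mset_set (carrier ?H))"
    by (simp only: qw mset_qu carH)
  ultimately have "D_walk ?H w"
    unfolding D_walk_def using w by blast
  then show ?thesis ..
qed

section \<open>Adding a coordinate to a power\<close>

lemma Z2_power_0_iso: "(\<lambda>x. (x, \<lambda>_. undefined)) \<in> iso N (N \<times>\<times> Z2_power 0)"
  by (auto simp: iso_def hom_def bij_betw_def inj_on_def product_group_def)

lemma bij_betw_append_coordinate:
  fixes k :: nat
  shows "bij_betw (\<lambda>((x, f), b). (x, f(k := b)))
    ((C \<times> ({..<k} \<rightarrow>\<^sub>E Z)) \<times> Z) (C \<times> ({..<Suc k} \<rightarrow>\<^sub>E Z))" (is "bij_betw ?h ?A ?B")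
proof (rule bij_betw_byWitness[where f' = "\<lambda>(x, f). ((x, f(k := undefined)), f k)"])
  show "?h ` ?A \<subseteq> ?B"
    by (auto simp: lessThan_Suc intro!: PiE_fun_upd)
  show "(\<lambda>(x, f). ((x, f(k := undefined)), f k)) ` ?B \<subseteq> ?A"
    by (auto simp: lessThan_Suc intro!: fun_upd_in_PiE)
  have "f k = undefined" if "f \<in> {..<k} \<rightarrow>\<^sub>E Z" for f
    using that by (rule PiE_arb) simp
  then show "\<forall>a\<in>?A. (\<lambda>(x, f). ((x, f(k := undefined)), f k)) (?h a) = a"
    by (clarsimp simp: fun_upd_idem_iff)
  show "\<forall>a\<in>?B. ?h ((\<lambda>(x, f). ((x, f(k := undefined)), f k)) a) = a"
    by clarsimp
qed

lemma Z2_power_Suc_iso: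
  "(\<lambda>((x, f), b). (x, f(k := b))) \<in>
     iso ((N \<times>\<times> Z2_power k) \<times>\<times> integer_mod_group 2) (N \<times>\<times> Z2_power (Suc k))"
    (is "?h \<in> iso ?G ?H")
proof (rule isoI)
  show bij: "bij_betw ?h (carrier ?G) (carrier ?H)"
    using bij_betw_append_coordinate by simp
  show "?h \<in> hom ?G ?H"
  proof (rule homI)
    show "?h a \<in> carrier ?H" if "a \<in> carrier ?G" for a
      using bij that by (rule bij_betwE[THEN bspec])
    show "?h (a \<otimes>\<^bsub>?G\<^esub> b) = ?h a \<otimes>\<^bsub>?H\<^esub> ?h b" for a b
      by (cases a; cases "fst a"; cases b; cases "fst b")
        (simp add: fun_eq_iff restrict_def less_Suc_eq)
  qed
qed

theorem lemma20:
  fixes N :: "('a, 'b) monoid_scheme" and k :: nat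
  assumes "group N" and "finite (carrier N)"
    and "sequenceable N" and "even (order N)"
  shows "\<exists>g. cyclic_D_sequence (N \<times>\<times> Z2_power k) g"
proof -
  have grp: "group (N \<times>\<times> Z2_power j)" for j
    by (intro DirProd_group assms(1) product_group) simp
  have fin: "finite (carrier (N \<times>\<times> Z2_power j))" for j
    using assms(2) by (auto simp: carrier_integer_mod_group intro!: finite_PiE)
  have even: "even (order (N \<times>\<times> Z2_power j))" for j
    using assms(4) by (simp add: order_def card_cartesian_product)
  have "\<exists>xs. D_walk (N \<times>\<times> Z2_power k) xs"
  proof (induction k)
    case 0
    obtain xs where "D_walk N xs"
      using group.sequenceable_imp_D_walk[OF assms(1-3)] by blast
    then show ?case
      using D_walk_iso[OF assms(1) grp Z2_power_0_iso _ assms(2)] by blast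
  next
    case (Suc k)
    then obtain xs where "D_walk (N \<times>\<times> Z2_power k) xs"
      by blast
    then obtain ws where "D_walk ((N \<times>\<times> Z2_power k) \<times>\<times> integer_mod_group 2) ws"
      using D_walk_double[OF grp fin even] by blast
    moreover have "group ((N \<times>\<times> Z2_power k) \<times>\<times> integer_mod_group 2)"
      by (intro DirProd_group grp) simp
    moreover have "finite (carrier ((N \<times>\<times> Z2_power k) \<times>\<times> integer_mod_group 2))"
      using fin[of k] by (auto simp: carrier_integer_mod_group)
    ultimately show ?case
      using D_walk_iso[OF _ grp Z2_power_Suc_iso] by blast
  qed
  then show ?thesis
    using cyclic_D_sequence_of_D_walk[OF fin] by blast
qed

end
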